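(* Let $\mathcal{A}$ be a finite-dimensional evolution algebra over a field $\mathbb{K}$. Then $\operatorname{rad}(\mathcal{A})$ is nilpotent.
   Context: An evolution algebra over a field $\mathbb{K}$ (arbitrary characteristic) is a $\mathbb{K}$-algebra $\mathcal{A}$ (not necessarily associative) admitting a basis $B=\{e_i\}_{i\in\Lambda}$, called a natural basis, with $e_ie_j=0$ for $i\neq j$. All algebras are finite-dimensional. An ideal $I$ of $\mathcal{A}$ has the absorption property if, for $x\in\mathcal{A}$, $x\mathcal{A}\subseteq I$ implies $x\in I$. The absorption radical $\operatorname{rad}(\mathcal{A})$ is the intersection of all ideals of $\mathcal{A}$ having the absorption property. An algebra $N$ is nilpotent if $N^n=0$ for some $n$, where $N^1=N$ and $N^n=\sum_{i=1}^{n-1}N^iN^{n-i}$; an ideal is nilpotent if it is nilpotent as an algebra. *)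

theory Defs
  imports Complex_Main
begin

locale nonassoc_algebra = vector_space scale
  for scale :: "'k::field \<Rightarrow> 'v::ab_group_add \<Rightarrow> 'v" (infixr "*s" 75) +
  fixes mult :: "'v \<Rightarrow> 'v \<Rightarrow> 'v" (infixl "\<star>" 70)
  assumes mult_add_left: "(x + y) \<star> z = x \<star> z + y \<star> z"
    and mult_add_right: "x \<star> (y + z) = x \<star> y + x \<star> z"
    and mult_scale_left: "(c *s x) \<star> y = c *s (x \<star> y)"
    and mult_scale_right: "x \<star> (c *s y) = c *s (x \<star> y)"
begin

definition natural_basis :: "'v set \<Rightarrow> bool" where
  "natural_basis B \<longleftrightarrow> independent B \<and> span B = UNIV \<and>
     (\<forall>e\<in>B. \<forall>f\<in>B. e \<noteq> f \<longrightarrow> e \<star> f = 0)"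

definition ideal :: "'v set \<Rightarrow> bool" where
  "ideal I \<longleftrightarrow> subspace I \<and> (\<forall>x\<in>I. \<forall>a. x \<star> a \<in> I \<and> a \<star> x \<in> I)"

definition absorption_property :: "'v set \<Rightarrow> bool" where
  "absorption_property I \<longleftrightarrow> (\<forall>x. range (\<lambda>a. x \<star> a) \<subseteq> I \<longrightarrow> x \<in> I)"

definition absorption_radical :: "'v set" where
  "absorption_radical = \<Inter> {I. ideal I \<and> absorption_property I}"

definition subspace_prod :: "'v set \<Rightarrow> 'v set \<Rightarrow> 'v set" where
  "subspace_prod S T = span {x \<star> y | x y. x \<in> S \<and> y \<in> T}"

text \<open>The powers are indexed from 1; the value at index 0 is a dummy. A sum of subspaces is
  written as the span of their union.\<close>

function algebra_power :: "'v set \<Rightarrow> nat \<Rightarrow> 'v set" where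
  "algebra_power N n =
     (if n \<le> 1 then N
      else span (\<Union>i\<in>{1..<n}. subspace_prod (algebra_power N i) (algebra_power N (n - i))))"
  by pat_completeness auto
termination by (relation "measure snd") auto

declare algebra_power.simps [simp del]

definition nilpotent :: "'v set \<Rightarrow> bool" where
  "nilpotent N \<longleftrightarrow> (\<exists>n\<ge>1. algebra_power N n = {0})"

lemma ideal_absorption_radical: "ideal absorption_radical"
  unfolding absorption_radical_def ideal_def subspace_def by blast

end

locale evolution_algebra = nonassoc_algebra +
  assumes ex_natural_basis: "\<exists>B. natural_basis B"

end

theory Submission
  imports Defs
begin

text \<open>
  The only consequence of the natural basis that matters is commutativity. In a commutative
  algebra \<open>A\<close> the upper annihilating series \<open>A\<^sub>0 = 0\<close>, \<open>A\<^sub>k\<^sub>+\<^sub>1 = {x. x \<star> A \<subseteq> A\<^sub>k}\<close> is an ascending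
  chain of ideals. In finite dimension it stabilises, say \<open>A\<^sub>m\<^sub>+\<^sub>1 = A\<^sub>m\<close>, and this equation says
  precisely that \<open>A\<^sub>m\<close> has the absorption property; hence the absorption radical \<open>N\<close> lies in
  \<open>A\<^sub>m\<close>. A product with one factor in \<open>A\<^sub>k\<^sub>+\<^sub>1\<close> lies in \<open>A\<^sub>k\<close>, and in each product
  \<open>N\<^sup>i N\<^sup>n\<^sup>-\<^sup>i\<close> one of the exponents is at least \<open>n/2\<close>. So passing from exponent \<open>2\<^sup>j\<close> to
  \<open>2\<^sup>j\<^sup>+\<^sup>1\<close> lowers the index of the series by one, and the power of \<open>N\<close> with exponent \<open>2\<^sup>m\<close> vanishes
  (\<open>algebra_power_subset_upper_annihilator\<close>).
\<close>

lemma (in finite_dimensional_vector_space) ascending_subspace_chain_stabilises: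
  assumes sub: "\<And>k. subspace (S k)" and mono: "\<And>k. S k \<subseteq> S (Suc k)"
  shows "\<exists>m. S (Suc m) = S m"
proof (rule ccontr)
  assume neq: "\<nexists>m. S (Suc m) = S m"
  have step: "dim (S k) < dim (S (Suc k))" for k
    using neq mono sub by (metis subspace_dim_equal not_less)
  have "k \<le> dim (S k)" for k
    by (induction k) (use step in \<open>auto simp: Suc_le_eq intro: le_less_trans\<close>)
  then have "Suc dimension \<le> dim (S (Suc dimension))" .
  moreover have "dim (S (Suc dimension)) \<le> dimension"
    by (metis dim_subset subset_UNIV dimension_def dim_UNIV)
  ultimately show False by simp
qed

context nonassoc_algebra
begin

lemma mult_zero_left [simp]: "0 \<star> y = 0"
  using mult_add_left[of 0 0 y] by simp

lemma mult_zero_right [simp]: "x \<star> 0 = 0"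
  using mult_add_right[of x 0 0] by simp

lemma natural_basis_mult_commute:
  assumes "natural_basis B"
  shows "x \<star> y = y \<star> x"
proof -
  have span: "span B = UNIV" and orth: "\<And>e f. e \<in> B \<Longrightarrow> f \<in> B \<Longrightarrow> e \<noteq> f \<Longrightarrow> e \<star> f = 0"
    using assms by (auto simp: natural_basis_def)
  have basis: "e \<star> f = f \<star> e" if "e \<in> B" "f \<in> B" for e f
    using orth[OF that] orth[OF that(2) that(1)] by (cases "e = f") auto
  have half: "e \<star> y = y \<star> e" if "e \<in> B" for e y
  proof -
    have "y \<in> span B" using span by simp
    then show ?thesis
      by (induction rule: span_induct_alt)
         (simp_all add: mult_add_left mult_add_right mult_scale_left mult_scale_right basis that)
  qed
  have "x \<in> span B" using span by simp
  then show ?thesis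
    by (induction rule: span_induct_alt)
       (auto simp: mult_add_left mult_add_right mult_scale_left mult_scale_right intro: half)
qed

text \<open>The upper annihilating series: the term after \<open>A\<^sub>k\<close> consists of the elements \<open>x\<close> with
  \<open>x \<star> A \<subseteq> A\<^sub>k\<close>, where \<open>A\<close> is the whole algebra.
  Only multiplication from the right is tested; commutativity makes the condition two-sided.\<close>

primrec upper_annihilator :: "nat \<Rightarrow> 'v set" where
  "upper_annihilator 0 = {0}"
| "upper_annihilator (Suc k) = {x. range (\<lambda>a. x \<star> a) \<subseteq> upper_annihilator k}"

lemma upper_annihilator_Suc_multD:
  "x \<in> upper_annihilator (Suc k) \<Longrightarrow> x \<star> a \<in> upper_annihilator k"
  by auto

lemma subspace_upper_annihilator: "subspace (upper_annihilator k)"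
proof (induction k)
  case (Suc k)
  then show ?case
    by (auto simp: subspace_def image_subset_iff mult_add_left mult_scale_left)
qed (simp add: subspace_def)

lemma upper_annihilator_le_Suc: "upper_annihilator k \<subseteq> upper_annihilator (Suc k)"
  by (induction k) auto

lemma ideal_upper_annihilator:
  assumes "\<And>x y. x \<star> y = y \<star> x"
  shows "ideal (upper_annihilator k)"
  unfolding ideal_def
  using upper_annihilator_Suc_multD upper_annihilator_le_Suc assms subspace_upper_annihilator
  by (metis subsetD)

lemma absorption_property_upper_annihilator:
  assumes "upper_annihilator (Suc m) = upper_annihilator m"
  shows "absorption_property (upper_annihilator m)"
  using assms by (auto simp: absorption_property_def)

lemma algebra_power_subsetI:
  assumes "subspace S" and "2 \<le> n"
    and prod: "\<And>i x y. \<lbrakk>1 \<le> i; i < n; x \<in> algebra_power N i; y \<in> algebra_power N (n - i)\<rbrakk>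
      \<Longrightarrow> x \<star> y \<in> S"
  shows "algebra_power N n \<subseteq> S"
proof -
  have "subspace_prod (algebra_power N i) (algebra_power N (n - i)) \<subseteq> S"
    if "i \<in> {1..<n}" for i
    unfolding subspace_prod_def using that prod by (intro span_minimal assms(1)) auto
  then have "span (\<Union>i\<in>{1..<n}. subspace_prod (algebra_power N i) (algebra_power N (n - i))) \<subseteq> S"
    by (intro span_minimal UN_least assms(1))
  then show ?thesis
    using assms(2) by (subst algebra_power.simps) simp
qed

lemma zero_in_algebra_power: "0 \<in> N \<Longrightarrow> 0 \<in> algebra_power N n"
  by (subst algebra_power.simps) (simp add: span_zero)

lemma algebra_power_subset:
  assumes "subspace S" and "N \<subseteq> S" and "\<And>x y. x \<in> S \<Longrightarrow> x \<star> y \<in> S"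
  shows "algebra_power N n \<subseteq> S"
proof (induction n rule: less_induct)
  case (less n)
  show ?case
  proof (cases "n \<le> 1")
    case True
    then show ?thesis by (subst algebra_power.simps) (simp add: assms(2))
  next
    case False
    show ?thesis
      by (rule algebra_power_subsetI[OF assms(1)]) (use False less.IH assms(3) in auto)
  qed
qed

text \<open>The induction on \<open>j\<close> keeps \<open>k + j\<close> fixed: each doubling of the exponent moves one step
  down the series. For \<open>j = 0\<close> it is enough that \<open>upper_annihilator k\<close> is an ideal
  containing \<open>N\<close>.\<close>

lemma algebra_power_subset_upper_annihilator:
  assumes comm: "\<And>x y. x \<star> y = y \<star> x"
    and N: "N \<subseteq> upper_annihilator (k + j)" and n: "2 ^ j \<le> n"
  shows "algebra_power N n \<subseteq> upper_annihilator k"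
  using N n
proof (induction j arbitrary: k n)
  case 0
  then show ?case
    using ideal_upper_annihilator[OF comm, of k]
    by (intro algebra_power_subset) (auto simp: ideal_def)
next
  case (Suc j)
  have IH: "algebra_power N i \<subseteq> upper_annihilator (Suc k)" if "2 ^ j \<le> i" for i
    using Suc.IH[of "Suc k" i] Suc.prems(1) that by simp
  show ?case
  proof (rule algebra_power_subsetI[OF subspace_upper_annihilator])
    have "1 \<le> (2::nat) ^ j" by (rule one_le_power) simp
    then show "2 \<le> n" using Suc.prems(2) unfolding power_Suc by linarith
  next
    fix i x y
    assume xy: "x \<in> algebra_power N i" "y \<in> algebra_power N (n - i)"
    have "2 ^ j \<le> i \<or> 2 ^ j \<le> n - i"
      using Suc.prems(2) by auto
    then show "x \<star> y \<in> upper_annihilator k"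
    proof
      assume "2 ^ j \<le> i"
      then show ?thesis using IH xy upper_annihilator_Suc_multD by blast
    next
      assume "2 ^ j \<le> n - i"
      then have "y \<star> x \<in> upper_annihilator k"
        using IH xy upper_annihilator_Suc_multD by blast
      then show ?thesis by (simp add: comm[of x y])
    qed
  qed
qed

lemma nilpotent_absorption_radical:
  assumes comm: "\<And>x y. x \<star> y = y \<star> x"
    and stable: "upper_annihilator (Suc m) = upper_annihilator m"
  shows "nilpotent absorption_radical"
proof -
  have "absorption_radical \<subseteq> upper_annihilator (0 + m)"
    using ideal_upper_annihilator[OF comm] absorption_property_upper_annihilator[OF stable]
    by (auto simp: absorption_radical_def)
  then have "algebra_power absorption_radical (2 ^ m) \<subseteq> {0}"
    using algebra_power_subset_upper_annihilator[OF comm, of absorption_radical 0 m "2 ^ m"] by simp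
  moreover have "0 \<in> algebra_power absorption_radical (2 ^ m)"
    using ideal_absorption_radical by (intro zero_in_algebra_power) (simp add: ideal_def subspace_0)
  ultimately show ?thesis
    unfolding nilpotent_def by (intro exI[of _ "2 ^ m"]) auto
qed

end

theorem corollary3p12:
  fixes scale :: "'k::field \<Rightarrow> 'v::ab_group_add \<Rightarrow> 'v"
    and mult :: "'v \<Rightarrow> 'v \<Rightarrow> 'v"
  assumes "evolution_algebra scale mult"
    and "\<exists>B. finite_dimensional_vector_space scale B"
  shows "nonassoc_algebra.nilpotent scale mult
           (nonassoc_algebra.absorption_radical scale mult)"
proof -
  interpret evolution_algebra scale mult by (fact assms(1))
  obtain B where "finite_dimensional_vector_space scale B" using assms(2) by blast
  then interpret fd: finite_dimensional_vector_space scale B .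
  obtain m where "upper_annihilator (Suc m) = upper_annihilator m"
    using fd.ascending_subspace_chain_stabilises[of upper_annihilator]
      subspace_upper_annihilator upper_annihilator_le_Suc by blast
  moreover obtain C where "natural_basis C" using ex_natural_basis by blast
  ultimately show ?thesis
    using nilpotent_absorption_radical natural_basis_mult_commute by blast
qed

end
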